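(* Let $(\Sigma,Q,\{v_1,\ldots,v_d\})$ be a fan fundamental triple in $\mathbb{R}^n$, where $\Sigma$ is a simplicial fan with convex support of full dimension $n$. Let $$\widetilde{X}_\Sigma=\bigsqcup_{\delta\subset\sigma}X_\delta^\sigma,$$ the disjoint union being over all pairs $(\delta,\sigma)$ of cones of $\Sigma$ with $\sigma$ maximal and $\delta$ a face of $\sigma$. For $y\in X_\delta^\sigma$ and $y'\in X_\gamma^\tau$ (with $\sigma,\tau\in\Sigma$ maximal, $\delta$ a face of $\sigma$, $\gamma$ a face of $\tau$) set $y\sim y'$ if and only if $y\in X^\sigma_{\delta\cap\gamma}$, $y'\in X^\tau_{\delta\cap\gamma}$ and $y'=h_{\gamma\delta}(y)$, where $h_{\gamma\delta}\colon X^\sigma_{\delta\cap\gamma}\to X^\tau_{\delta\cap\gamma}$ is the affine toric morphism induced by the identity of $\mathbb{R}^n$. Then $\sim$ is an equivalence relation on $\widetilde{X}_\Sigma$.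
   Context: A quasilattice $Q$ in $\mathbb{R}^n$ is the $\mathbb{Z}$-span of a set of vectors that spans $\mathbb{R}^n$. A simplicial cone is the set of non-negative real combinations of linearly independent vectors (its ray generators); its faces are the cones generated by subsets of the ray generators (including $\{0\}$ and the cone itself). A simplicial fan $\Sigma$ in $\mathbb{R}^n$ is a finite collection of simplicial cones such that every face of a cone of $\Sigma$ is in $\Sigma$ and the intersection of any two cones of $\Sigma$ is a face of each. Its support is the union of its cones. A maximal cone is an $n$-dimensional one. A fan fundamental triple $(\Sigma,Q,\{v_1,\ldots,v_d\})$ in $\mathbb{R}^n$ consists of a quasilattice $Q\subset\mathbb{R}^n$, a simplicial fan $\Sigma$ with $d$ rays, and vectors $v_1,\ldots,v_d\in Q$ generating the $d$ rays of $\Sigma$. For a maximal cone $\sigma\in\Sigma$, let $I_\sigma\subset\{1,\ldots,d\}$ be the set of $n$ indices with $\sigma$ generated by $\{v_i\}_{i\in I_\sigma}$, let $\{\alpha_i^\sigma\}_{i\in I_\sigma}$ be the basis of $(\mathbb{R}^n)^*$ dual to $\{v_i\}_{i\in I_\sigma}$, let $L_\sigma=\bigoplus_{i\in I_\sigma}\mathbb{Z}v_i\subset Q$ and $\Gamma_\sigma=Q/L_\sigma$. The group $\Gamma_\sigma$ acts on $\mathbb{C}^{I_\sigma}\cong\mathbb{C}^n$ by $[v]\cdot(z_i)_{i\in I_\sigma}=(e^{2\pi i\alpha_i^\sigma(v)}z_i)_{i\in I_\sigma}$, $v\in Q$. For a face $\delta$ of $\sigma$, generated by $\{v_i\}_{i\in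 I_\delta}$ with $I_\delta\subseteq I_\sigma$, let $U_\delta^\sigma=\{z\in\mathbb{C}^{I_\sigma}\mid z_i\ne0\text{ for }i\in I_\sigma\setminus I_\delta\}$ and $X_\delta^\sigma=U_\delta^\sigma/\Gamma_\sigma$. If $\rho$ is a face of $\delta$, then $U_\rho^\sigma\subset U_\delta^\sigma$, and $X_\rho^\sigma$ is regarded as a subset of $X_\delta^\sigma$ via the induced inclusion. For $\delta$ a face of $\sigma$ and $\gamma$ a face of $\tau$ ($\sigma,\tau$ maximal), the cone $\delta\cap\gamma$ is a face of both $\sigma$ and $\tau$, and $$h_{\gamma\delta}\colon X^\sigma_{\delta\cap\gamma}\to X^\tau_{\delta\cap\gamma},\qquad h_{\gamma\delta}\big([(z_k)_{k\in I_\sigma}]\big)=\Big[\Big(\prod_{k\in I_\sigma}z_k^{\alpha_i^\tau(v_k)}\Big)_{i\in I_\tau}\Big].$$ Convention on real powers: for each nonzero $z_k$ choose $x_k\in\mathbb{C}$ with $z_k=e^{2\pi i x_k}$ (the same choice for all monomials) and set $z_k^a=e^{2\pi i a x_k}$ for $a\in\mathbb{R}$; if $z_k=0$, then $z_k^a=0$ for $a>0$ and $z_k^0=1$ (negative exponents do not occur for $z_k=0$). The map $h_{\gamma\delta}$ is well defined (independent of all choices); it depends on $\sigma,\tau$ although the notation does not record it. *)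

theory Defs
  imports "HOL-Analysis.Analysis" "HOL-Algebra.Group_Action"
begin

definition int_span :: "'a::real_vector set \<Rightarrow> 'a set" where
  "int_span S = {\<Sum>u\<in>T. of_int (c u) *\<^sub>R u | T c. finite T \<and> T \<subseteq> S}"

definition quasilattice :: "(real ^ 'n) set \<Rightarrow> bool" where
  "quasilattice Q \<longleftrightarrow> (\<exists>S. span S = UNIV \<and> Q = int_span S)"

text \<open>Only used for finite \<open>S\<close> (linearly independent sets in $\mathbb{R}^n$ are finite).\<close>

definition cone_gen :: "'a::real_vector set \<Rightarrow> 'a set" where
  "cone_gen S = {\<Sum>u\<in>S. c u *\<^sub>R u | c. \<forall>u\<in>S. 0 \<le> c u}"

definition simplicial_cone :: "(real ^ 'n) set \<Rightarrow> bool" where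
  "simplicial_cone \<sigma> \<longleftrightarrow> (\<exists>S. independent S \<and> \<sigma> = cone_gen S)"

text \<open>Ray generators are unique up to positive scaling, so it does not matter which
  generating set \<open>S\<close> is used. Unlike with \<open>face_of\<close>, the empty set is not a face.\<close>

definition cone_face :: "(real ^ 'n) set \<Rightarrow> (real ^ 'n) set \<Rightarrow> bool" where
  "cone_face \<delta> \<sigma> \<longleftrightarrow>
     (\<exists>S T. independent S \<and> \<sigma> = cone_gen S \<and> T \<subseteq> S \<and> \<delta> = cone_gen T)"

definition simplicial_fan :: "(real ^ 'n) set set \<Rightarrow> bool" where
  "simplicial_fan \<Sigma> \<longleftrightarrow>
     finite \<Sigma> \<and> (\<forall>\<sigma>\<in>\<Sigma>. simplicial_cone \<sigma>) \<and>
     (\<forall>\<sigma>\<in>\<Sigma>. \<forall>\<delta>. cone_face \<delta> \<sigma> \<longrightarrow> \<delta> \<in> \<Sigma>) \<and>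
     (\<forall>\<sigma>\<in>\<Sigma>. \<forall>\<tau>\<in>\<Sigma>. cone_face (\<sigma> \<inter> \<tau>) \<sigma> \<and> cone_face (\<sigma> \<inter> \<tau>) \<tau>)"

definition fan_support :: "(real ^ 'n) set set \<Rightarrow> (real ^ 'n) set" where
  "fan_support \<Sigma> = \<Union>\<Sigma>"

definition maximal_cone :: "(real ^ 'n) set set \<Rightarrow> (real ^ 'n) set \<Rightarrow> bool" where
  "maximal_cone \<Sigma> \<sigma> \<longleftrightarrow> \<sigma> \<in> \<Sigma> \<and> dim \<sigma> = CARD('n)"

definition fan_rays :: "(real ^ 'n) set set \<Rightarrow> (real ^ 'n) set set" where
  "fan_rays \<Sigma> = {\<rho> \<in> \<Sigma>. dim \<rho> = 1}"

definition fan_triple ::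
  "(real ^ 'n) set set \<Rightarrow> (real ^ 'n) set \<Rightarrow> nat \<Rightarrow> (nat \<Rightarrow> real ^ 'n) \<Rightarrow> bool" where
  "fan_triple \<Sigma> Q d v \<longleftrightarrow>
     quasilattice Q \<and> simplicial_fan \<Sigma> \<and> (\<forall>i\<in>{1..d}. v i \<in> Q) \<and>
     bij_betw (\<lambda>i. cone_gen {v i}) {1..d} (fan_rays \<Sigma>)"

definition max_index :: "nat \<Rightarrow> (nat \<Rightarrow> real ^ 'n) \<Rightarrow> (real ^ 'n) set \<Rightarrow> nat set" where
  "max_index d v \<sigma> = (THE I. I \<subseteq> {1..d} \<and> card I = CARD('n) \<and> \<sigma> = cone_gen (v ` I))"

text \<open>The index set of a face \<open>\<delta>\<close> of a maximal cone \<open>\<sigma>\<close>.\<close>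

definition face_index ::
  "nat \<Rightarrow> (nat \<Rightarrow> real ^ 'n) \<Rightarrow> (real ^ 'n) set \<Rightarrow> (real ^ 'n) set \<Rightarrow> nat set" where
  "face_index d v \<sigma> \<delta> = (THE J. J \<subseteq> max_index d v \<sigma> \<and> \<delta> = cone_gen (v ` J))"

definition dual_basis ::
  "nat \<Rightarrow> (nat \<Rightarrow> real ^ 'n) \<Rightarrow> (real ^ 'n) set \<Rightarrow> nat \<Rightarrow> real ^ 'n \<Rightarrow> real" where
  "dual_basis d v \<sigma> i =
     (THE f. linear f \<and> (\<forall>j\<in>max_index d v \<sigma>. f (v j) = (if j = i then 1 else 0)))"

definition add_monoid_on :: "'a::ab_group_add set \<Rightarrow> 'a monoid" where
  "add_monoid_on Q = \<lparr>carrier = Q, monoid.mult = (+), one = 0\<rparr>"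

definition cone_group ::
  "nat \<Rightarrow> (nat \<Rightarrow> real ^ 'n) \<Rightarrow> (real ^ 'n) set \<Rightarrow> (real ^ 'n) set \<Rightarrow> (real ^ 'n) set monoid" where
  "cone_group d v Q \<sigma> = add_monoid_on Q Mod int_span (v ` max_index d v \<sigma>)"

text \<open>\<open>\<complex>\<^bsup>I\<^esup>\<close> is represented by the functions \<open>nat \<Rightarrow> complex\<close> that are
  \<open>undefined\<close> outside \<open>I\<close>. The action of a coset \<open>g\<close> does not depend on the
  representative \<open>u\<close>, which is what the definite description expresses.\<close>

definition cone_act ::
  "nat \<Rightarrow> (nat \<Rightarrow> real ^ 'n) \<Rightarrow> (real ^ 'n) set \<Rightarrow> (real ^ 'n) set \<Rightarrow>
     (nat \<Rightarrow> complex) \<Rightarrow> (nat \<Rightarrow> complex)" where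
  "cone_act d v \<sigma> g z =
     (THE w. \<exists>u\<in>g. w = (\<lambda>i\<in>max_index d v \<sigma>.
        exp (2 * complex_of_real pi * \<i> * complex_of_real (dual_basis d v \<sigma> i u)) * z i))"

definition chart_dom ::
  "nat \<Rightarrow> (nat \<Rightarrow> real ^ 'n) \<Rightarrow> (real ^ 'n) set \<Rightarrow> (real ^ 'n) set \<Rightarrow> (nat \<Rightarrow> complex) set" where
  "chart_dom d v \<sigma> \<delta> =
     {z \<in> max_index d v \<sigma> \<rightarrow>\<^sub>E UNIV. \<forall>i\<in>max_index d v \<sigma> - face_index d v \<sigma> \<delta>. z i \<noteq> 0}"

text \<open>Points are orbits, so that for a face \<open>\<rho>\<close> of \<open>\<delta>\<close> the inclusion
  \<open>chart d v Q \<sigma> \<rho> \<subseteq> chart d v Q \<sigma> \<delta>\<close> is literal.\<close>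

definition chart ::
  "nat \<Rightarrow> (nat \<Rightarrow> real ^ 'n) \<Rightarrow> (real ^ 'n) set \<Rightarrow> (real ^ 'n) set \<Rightarrow> (real ^ 'n) set \<Rightarrow>
     (nat \<Rightarrow> complex) set set" where
  "chart d v Q \<sigma> \<delta> = orbits (cone_group d v Q \<sigma>) (chart_dom d v \<sigma> \<delta>) (cone_act d v \<sigma>)"

text \<open>The power \<open>z\<^sup>a\<close> computed from a chosen \<open>x\<close> with \<open>z = exp (2 \<pi> \<i> x)\<close>;
  \<open>x\<close> is irrelevant for \<open>z = 0\<close>, where negative \<open>a\<close> never occur.\<close>

definition log_power :: "complex \<Rightarrow> complex \<Rightarrow> real \<Rightarrow> complex" where
  "log_power z x a =
     (if z = 0 then (if a = 0 then 1 else 0)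
      else exp (2 * complex_of_real pi * \<i> * complex_of_real a * x))"

definition log_choice :: "nat set \<Rightarrow> (nat \<Rightarrow> complex) \<Rightarrow> (nat \<Rightarrow> complex) \<Rightarrow> bool" where
  "log_choice I z x \<longleftrightarrow>
     (\<forall>k\<in>I. z k \<noteq> 0 \<longrightarrow> z k = exp (2 * complex_of_real pi * \<i> * x k))"

definition monomial_map ::
  "nat \<Rightarrow> (nat \<Rightarrow> real ^ 'n) \<Rightarrow> (real ^ 'n) set \<Rightarrow> (real ^ 'n) set \<Rightarrow>
     (nat \<Rightarrow> complex) \<Rightarrow> (nat \<Rightarrow> complex) \<Rightarrow> (nat \<Rightarrow> complex)" where
  "monomial_map d v \<sigma> \<tau> z x =
     (\<lambda>i\<in>max_index d v \<tau>. \<Prod>k\<in>max_index d v \<sigma>. log_power (z k) (x k) (dual_basis d v \<tau> i (v k)))"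

text \<open>The map $h_{\gamma\delta}$ from the \<open>\<sigma>\<close>-chart to the \<open>\<tau>\<close>-chart of \<open>\<delta> \<inter> \<gamma>\<close>. Its value is
  independent of the representative \<open>z\<close> of the orbit \<open>y\<close> and of the logarithms \<open>x\<close>.\<close>

definition transition ::
  "nat \<Rightarrow> (nat \<Rightarrow> real ^ 'n) \<Rightarrow> (real ^ 'n) set \<Rightarrow>
     (real ^ 'n) set \<Rightarrow> (real ^ 'n) set \<Rightarrow> (real ^ 'n) set \<Rightarrow> (real ^ 'n) set \<Rightarrow>
     (nat \<Rightarrow> complex) set \<Rightarrow> (nat \<Rightarrow> complex) set" where
  "transition d v Q \<delta> \<sigma> \<gamma> \<tau> =
     (\<lambda>y\<in>chart d v Q \<sigma> (\<delta> \<inter> \<gamma>).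
        THE y'. \<exists>z\<in>y. \<exists>x. log_choice (max_index d v \<sigma>) z x \<and>
          y' = orbit (cone_group d v Q \<tau>) (cone_act d v \<tau>) (monomial_map d v \<sigma> \<tau> z x))"

definition face_pairs :: "(real ^ 'n) set set \<Rightarrow> ((real ^ 'n) set \<times> (real ^ 'n) set) set" where
  "face_pairs \<Sigma> = {(\<delta>, \<sigma>). \<delta> \<in> \<Sigma> \<and> maximal_cone \<Sigma> \<sigma> \<and> cone_face \<delta> \<sigma>}"

definition total_space ::
  "(real ^ 'n) set set \<Rightarrow> (real ^ 'n) set \<Rightarrow> nat \<Rightarrow> (nat \<Rightarrow> real ^ 'n) \<Rightarrow>
     (((real ^ 'n) set \<times> (real ^ 'n) set) \<times> (nat \<Rightarrow> complex) set) set" where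
  "total_space \<Sigma> Q d v = (SIGMA (\<delta>, \<sigma>) : face_pairs \<Sigma>. chart d v Q \<sigma> \<delta>)"

definition glue_rel ::
  "(real ^ 'n) set set \<Rightarrow> (real ^ 'n) set \<Rightarrow> nat \<Rightarrow> (nat \<Rightarrow> real ^ 'n) \<Rightarrow>
     ((((real ^ 'n) set \<times> (real ^ 'n) set) \<times> (nat \<Rightarrow> complex) set) \<times>
      (((real ^ 'n) set \<times> (real ^ 'n) set) \<times> (nat \<Rightarrow> complex) set)) set" where
  "glue_rel \<Sigma> Q d v =
     {(((\<delta>, \<sigma>), y), ((\<gamma>, \<tau>), y')) | \<delta> \<sigma> y \<gamma> \<tau> y'.
        ((\<delta>, \<sigma>), y) \<in> total_space \<Sigma> Q d v \<and> ((\<gamma>, \<tau>), y') \<in> total_space \<Sigma> Q d v \<and>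
        y \<in> chart d v Q \<sigma> (\<delta> \<inter> \<gamma>) \<and> y' \<in> chart d v Q \<tau> (\<delta> \<inter> \<gamma>) \<and>
        y' = transition d v Q \<delta> \<sigma> \<gamma> \<tau> y}"

end

theory Submission
  imports Defs
begin

text \<open>A point of the chart of a maximal cone \<open>\<sigma>\<close> is determined by the set \<open>Z\<close> of its vanishing
  coordinates and by the class \<open>\<xi> = \<Sum> x\<^sub>k v\<^sub>k\<close> of logarithms of the others, taken in \<open>\<complex>\<^sup>n\<close> modulo
  \<open>Q\<close> and the complex span of \<open>{v\<^sub>i | i \<in> Z}\<close>. This description does not mention \<open>\<sigma>\<close>, and the map
  \<open>h\<close> from the \<open>\<sigma>\<close>-chart to the \<open>\<tau>\<close>-chart is the identity in terms of it. So two points are related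
  iff they have the same data \<open>(Z, \<xi>)\<close>. Each ray of \<open>Z\<close> then lies in every cone involved, which is
  what transitivity needs.\<close>

section \<open>Integer spans and cones\<close>

lemma int_span_add:
  assumes "x \<in> int_span S" "y \<in> int_span S"
  shows "x + y \<in> int_span S"
proof -
  obtain T c where T: "finite T" "T \<subseteq> S" and x: "x = (\<Sum>u\<in>T. of_int (c u) *\<^sub>R u)"
    using assms(1) by (auto simp: int_span_def)
  obtain T' c' where T': "finite T'" "T' \<subseteq> S" and y: "y = (\<Sum>u\<in>T'. of_int (c' u) *\<^sub>R u)"
    using assms(2) by (auto simp: int_span_def)
  define b where "b u = (if u \<in> T then c u else 0) + (if u \<in> T' then c' u else 0)" for u
  have "x = (\<Sum>u\<in>T \<union> T'. of_int (if u \<in> T then c u else 0) *\<^sub>R u)"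
    unfolding x using T T' by (intro sum.mono_neutral_cong_left) auto
  moreover have "y = (\<Sum>u\<in>T \<union> T'. of_int (if u \<in> T' then c' u else 0) *\<^sub>R u)"
    unfolding y using T T' by (intro sum.mono_neutral_cong_left) auto
  ultimately have "x + y = (\<Sum>u\<in>T \<union> T'. of_int (b u) *\<^sub>R u)"
    by (simp add: b_def sum.distrib scaleR_add_left)
  then show ?thesis
    using T T' unfolding int_span_def by (intro CollectI exI[of _ "T \<union> T'"] exI[of _ b]) auto
qed

lemma int_span_scale:
  assumes "x \<in> int_span S"
  shows "of_int m *\<^sub>R x \<in> int_span S"
proof -
  obtain T c where T: "finite T" "T \<subseteq> S" and x: "x = (\<Sum>u\<in>T. of_int (c u) *\<^sub>R u)"
    using assms by (auto simp: int_span_def)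
  have "of_int m *\<^sub>R x = (\<Sum>u\<in>T. of_int (m * c u) *\<^sub>R u)"
    by (simp add: x scaleR_sum_right)
  then show ?thesis
    using T unfolding int_span_def by (intro CollectI exI[of _ T] exI[of _ "\<lambda>u. m * c u"]) auto
qed

lemma int_span_0: "0 \<in> int_span S"
  unfolding int_span_def by (intro CollectI exI[of _ "{}"]) auto

section \<open>Finitely generated cones\<close>

lemma convex_cone_cone_gen: "convex_cone (cone_gen S)"
proof -
  have "(\<Sum>u\<in>S. a u *\<^sub>R u) + (\<Sum>u\<in>S. b u *\<^sub>R u) \<in> cone_gen S"
    if "\<forall>u\<in>S. 0 \<le> a u" "\<forall>u\<in>S. 0 \<le> b u" for a b
    using that unfolding cone_gen_def
    by (intro CollectI exI[of _ "\<lambda>u. a u + b u"]) (auto simp: sum.distrib scaleR_add_left)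
  moreover have "t *\<^sub>R (\<Sum>u\<in>S. a u *\<^sub>R u) \<in> cone_gen S"
    if "\<forall>u\<in>S. 0 \<le> a u" "0 \<le> t" for a t
    using that unfolding cone_gen_def
    by (intro CollectI exI[of _ "\<lambda>u. t * a u"]) (auto simp: scaleR_sum_right)
  moreover have "0 \<in> cone_gen S"
    unfolding cone_gen_def by (intro CollectI exI[of _ "\<lambda>u. 0"]) auto
  ultimately show ?thesis
    unfolding convex_cone_iff by (auto simp: cone_gen_def)
qed

lemma generator_in_cone_gen:
  assumes "finite S" "s \<in> S"
  shows "s \<in> cone_gen S"
proof -
  have "(\<Sum>u\<in>S. (if u = s then 1 else 0) *\<^sub>R u) = s"
    using assms by (simp add: if_distrib[of "\<lambda>c. c *\<^sub>R _"] cong: if_cong)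
  then show ?thesis
    unfolding cone_gen_def by (intro CollectI exI[of _ "\<lambda>u. if u = s then 1 else 0"]) auto
qed

lemma convex_cone_sum:
  assumes "convex_cone K" "\<And>i. i \<in> I \<Longrightarrow> f i \<in> K"
  shows "sum f I \<in> K"
  using assms
  \<comment> \<open>Over an infinite index set the sum is 0 by convention, and 0 lies in the
    cone.\<close>
  by (induction I rule: infinite_finite_induct) (auto simp: convex_cone_contains_0 convex_cone_add)

lemma cone_gen_minimal:
  assumes "convex_cone K" "S \<subseteq> K"
  shows "cone_gen S \<subseteq> K"
  using assms unfolding cone_gen_def by (auto intro!: convex_cone_sum convex_cone_scaleR)

lemma cone_gen_singleton: "cone_gen {x} = {c *\<^sub>R x | c. 0 \<le> c}"
  by (auto simp: cone_gen_def)

lemma cone_gen_singleton_scale: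
  assumes "c > 0"
  shows "cone_gen {c *\<^sub>R x} = cone_gen {x}"
proof
  show "cone_gen {c *\<^sub>R x} \<subseteq> cone_gen {x}"
    using assms by (intro cone_gen_minimal convex_cone_cone_gen) (auto simp: cone_gen_singleton)
  show "cone_gen {x} \<subseteq> cone_gen {c *\<^sub>R x}"
    using assms by (intro cone_gen_minimal convex_cone_cone_gen)
      (auto simp: cone_gen_singleton intro!: exI[of _ "inverse c"])
qed

lemma span_cone_gen:
  assumes "finite S"
  shows "span (cone_gen S) = span S"
proof
  show "span (cone_gen S) \<subseteq> span S"
    by (rule span_minimal) (auto simp: cone_gen_def intro!: span_sum intro: span_scale span_base)
  show "span S \<subseteq> span (cone_gen S)"
    using assms by (intro span_mono) (auto intro: generator_in_cone_gen)
qed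

lemma dim_cone_gen:
  fixes S :: "(real ^ 'n) set"
  assumes "independent S"
  shows "dim (cone_gen S) = card S"
  using assms span_cone_gen[of S] by (metis dim_span dim_eq_card_independent independent_imp_finite)

section \<open>Faces as extremal subcones\<close>

text \<open>A notion of face that mentions no generators, so it can be composed first and applied to
  any generating set later. By commutativity the condition on \<open>x\<close> also covers
  \<open>y\<close>.\<close>

definition extremal_subcone :: "'a::real_vector set \<Rightarrow> 'a set \<Rightarrow> bool" where
  "extremal_subcone \<delta> \<sigma> \<longleftrightarrow>
     convex_cone \<delta> \<and> \<delta> \<subseteq> \<sigma> \<and> (\<forall>x\<in>\<sigma>. \<forall>y\<in>\<sigma>. x + y \<in> \<delta> \<longrightarrow> x \<in> \<delta>)"

lemma extremal_subcone_trans: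
  assumes "extremal_subcone \<rho> \<delta>" "extremal_subcone \<delta> \<sigma>"
  shows "extremal_subcone \<rho> \<sigma>"
proof -
  have "x \<in> \<rho>" if "x \<in> \<sigma>" "y \<in> \<sigma>" "x + y \<in> \<rho>" for x y
  proof -
    have "x + y \<in> \<delta>" using that assms by (auto simp: extremal_subcone_def)
    then have "x \<in> \<delta>" "y \<in> \<delta>"
      using that assms(2) unfolding extremal_subcone_def by (blast, metis add.commute)
    with that assms(1) show ?thesis unfolding extremal_subcone_def by blast
  qed
  with assms show ?thesis unfolding extremal_subcone_def by blast
qed

text \<open>Independence allows coefficients to be compared: outside \<open>T\<close> the
  nonnegative coefficients of \<open>x\<close> and \<open>y\<close> add up to 0, so both
  vanish.\<close>

lemma cone_face_extremal:
  assumes "cone_face \<delta> \<sigma>"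
  shows "extremal_subcone \<delta> \<sigma>"
proof -
  obtain S T where S: "independent S" "\<sigma> = cone_gen S" and T: "T \<subseteq> S" "\<delta> = cone_gen T"
    using assms by (auto simp: cone_face_def)
  have fin: "finite S" using S(1) by (rule independent_imp_finite)
  have sub: "\<delta> \<subseteq> \<sigma>"
    unfolding S T using fin T(1)
    by (intro cone_gen_minimal convex_cone_cone_gen) (auto intro: generator_in_cone_gen)
  have "x \<in> \<delta>" if xy: "x \<in> \<sigma>" "y \<in> \<sigma>" "x + y \<in> \<delta>" for x y
  proof -
    obtain a where a: "\<forall>u\<in>S. 0 \<le> a u" "x = (\<Sum>u\<in>S. a u *\<^sub>R u)"
      using xy(1) S by (auto simp: cone_gen_def)
    obtain b where b: "\<forall>u\<in>S. 0 \<le> b u" "y = (\<Sum>u\<in>S. b u *\<^sub>R u)"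
      using xy(2) S by (auto simp: cone_gen_def)
    obtain c where c: "x + y = (\<Sum>u\<in>T. c u *\<^sub>R u)"
      using xy(3) T by (auto simp: cone_gen_def)
    have "(\<Sum>u\<in>T. c u *\<^sub>R u) = (\<Sum>u\<in>S. (if u \<in> T then c u else 0) *\<^sub>R u)"
      using fin T(1) by (intro sum.mono_neutral_cong_left) auto
    then have "(\<Sum>u\<in>S. (a u + b u - (if u \<in> T then c u else 0)) *\<^sub>R u) = 0"
      using a b c by (simp add: scaleR_diff_left scaleR_add_left sum.distrib sum_subtractf)
    then have *: "a u + b u - (if u \<in> T then c u else 0) = 0" if "u \<in> S" for u
      by (rule independentD[OF S(1) fin subset_refl _ that])
    have "a u = 0" if "u \<in> S - T" for u
      using *[of u] that a(1) b(1) by (auto simp: add_nonneg_eq_0_iff)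
    then have "x = (\<Sum>u\<in>T. a u *\<^sub>R u)"
      unfolding a using fin T(1) by (intro sum.mono_neutral_right) auto
    then show ?thesis using a(1) T by (auto simp: cone_gen_def)
  qed
  with sub show ?thesis
    unfolding extremal_subcone_def T by (auto simp: convex_cone_cone_gen)
qed

text \<open>If \<open>u\<close> occurs in an element of \<open>\<rho>\<close> with nonzero
  coefficient, its term is a summand of that element, hence lies in \<open>\<rho>\<close>, and
  rescaling gives \<open>u\<close> itself. \<open>S\<close> is any finite generating set, so this
  applies to the ray vectors \<open>v i\<close> too.\<close>

lemma extremal_subcone_generators:
  assumes "finite S" "extremal_subcone \<rho> (cone_gen S)"
  shows "\<rho> = cone_gen (S \<inter> \<rho>)"
proof
  have cc: "convex_cone \<rho>" and sub: "\<rho> \<subseteq> cone_gen S"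
    using assms(2) by (auto simp: extremal_subcone_def)
  show "cone_gen (S \<inter> \<rho>) \<subseteq> \<rho>"
    using cc by (intro cone_gen_minimal) auto
  show "\<rho> \<subseteq> cone_gen (S \<inter> \<rho>)"
  proof
    fix x assume x: "x \<in> \<rho>"
    then obtain a where a: "\<forall>u\<in>S. 0 \<le> a u" "x = (\<Sum>u\<in>S. a u *\<^sub>R u)"
      using sub by (auto simp: cone_gen_def)
    have in_gen: "a u *\<^sub>R u \<in> cone_gen S" if "u \<in> S" for u
      using that a(1) assms(1) by (auto intro: convex_cone_scaleR convex_cone_cone_gen generator_in_cone_gen)
    have "u \<in> \<rho>" if u: "u \<in> S" "a u \<noteq> 0" for u
    proof -
      have "x = a u *\<^sub>R u + (\<Sum>w\<in>S - {u}. a w *\<^sub>R w)"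
        using a(2) u assms(1) by (simp add: sum.remove)
      moreover have "(\<Sum>w\<in>S - {u}. a w *\<^sub>R w) \<in> cone_gen S"
        by (intro convex_cone_sum convex_cone_cone_gen in_gen) auto
      ultimately have "a u *\<^sub>R u \<in> \<rho>"
        using assms(2) x in_gen[OF u(1)] unfolding extremal_subcone_def by blast
      then have "inverse (a u) *\<^sub>R (a u *\<^sub>R u) \<in> \<rho>"
        using a(1) u(1) convex_cone_scaleR[OF cc] by (metis inverse_nonnegative_iff_nonnegative)
      with u(2) show ?thesis by simp
    qed
    then have "x = (\<Sum>u\<in>S \<inter> \<rho>. a u *\<^sub>R u)"
      unfolding a(2) using assms(1) by (intro sum.mono_neutral_right) auto
    then show "x \<in> cone_gen (S \<inter> \<rho>)"
      using a(1) by (auto simp: cone_gen_def)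
  qed
qed

text \<open>Used for the uniqueness of the index set in \<open>face_index\<close>: no member of an
  independent set lies in the span of the others.\<close>

lemma independent_generator_in_subcone:
  assumes "independent S" "T \<subseteq> S" "s \<in> S" "s \<in> cone_gen T"
  shows "s \<in> T"
proof (rule ccontr)
  assume "s \<notin> T"
  have "s \<in> span T"
    using assms(4) by (auto simp: cone_gen_def intro!: span_sum intro: span_scale span_base)
  moreover have "T \<subseteq> S - {s}"
    using assms(2) \<open>s \<notin> T\<close> by auto
  ultimately have "s \<in> span (S - {s})"
    using span_mono by auto
  with assms(1,3) show False by (auto simp: dependent_def)
qed

section \<open>Exponential coordinates\<close>

text \<open>The covering of the nonzero complex numbers by the complex plane, normalised so that its
  kernel is \<int>.\<close>

definition unit_exp :: "complex \<Rightarrow> complex" where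
  "unit_exp x = exp (2 * complex_of_real pi * \<i> * x)"

lemma unit_exp_0 [simp]: "unit_exp 0 = 1"
  by (simp add: unit_exp_def)

lemma unit_exp_nonzero [simp]: "unit_exp x \<noteq> 0"
  by (simp add: unit_exp_def)

lemma unit_exp_add: "unit_exp (x + y) = unit_exp x * unit_exp y"
  by (simp add: unit_exp_def distrib_left exp_add)

lemma unit_exp_sum: "finite I \<Longrightarrow> unit_exp (\<Sum>i\<in>I. f i) = (\<Prod>i\<in>I. unit_exp (f i))"
  by (induction I rule: finite_induct) (auto simp: unit_exp_add)

lemma unit_exp_eq_iff: "unit_exp x = unit_exp y \<longleftrightarrow> (\<exists>m::int. x = y + of_int m)"
proof -
  \<comment> \<open>The right-hand side copies the period in the form in which \<open>exp_eq\<close>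
    states it.\<close>
  have "2 * complex_of_real pi * \<i> * x = 2 * complex_of_real pi * \<i> * y
          + complex_of_real (of_int (2 * m) * pi) * \<i> \<longleftrightarrow> x = y + of_int m" for m :: int
  proof -
    have "2 * complex_of_real pi * \<i> * y + complex_of_real (of_int (2 * m) * pi) * \<i>
          = 2 * complex_of_real pi * \<i> * (y + of_int m)"
      by (simp add: algebra_simps)
    then show ?thesis by simp
  qed
  then show ?thesis unfolding unit_exp_def exp_eq by simp
qed

lemma unit_exp_of_int: "unit_exp (of_int m) = 1"
  using unit_exp_eq_iff[of "of_int m" 0] by auto

lemma unit_exp_surj:
  assumes "z \<noteq> 0"
  obtains x where "z = unit_exp x"
proof
  show "z = unit_exp (Ln z / (2 * complex_of_real pi * \<i>))"
    using assms by (simp add: unit_exp_def)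
qed

lemma log_power_eq:
  "log_power z x a =
     (if z = 0 then (if a = 0 then 1 else 0) else unit_exp (complex_of_real a * x))"
  by (simp add: log_power_def unit_exp_def mult.assoc)

text \<open>A vector \<open>a + \<i> b\<close> of the complexification of \<open>'a\<close> is encoded as the pair \<open>(a, b)\<close>;
  \<open>complexify f\<close> is the complex-linear extension of a real functional \<open>f\<close>.\<close>

definition complexify :: "('a \<Rightarrow> real) \<Rightarrow> 'a \<times> 'a \<Rightarrow> complex" where
  "complexify f \<xi> = Complex (f (fst \<xi>)) (f (snd \<xi>))"

definition complex_scale :: "complex \<Rightarrow> 'a::real_vector \<Rightarrow> 'a \<times> 'a" where
  "complex_scale c x = (Re c *\<^sub>R x, Im c *\<^sub>R x)"

lemma complexify_add:
  "linear f \<Longrightarrow> complexify f (\<xi> + \<eta>) = complexify f \<xi> + complexify f \<eta>"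
  by (simp add: complexify_def complex_eq_iff linear_add)

lemma complexify_real: "linear f \<Longrightarrow> complexify f (u, 0) = complex_of_real (f u)"
  by (simp add: complexify_def complex_eq_iff linear_0)

lemma complexify_0: "linear f \<Longrightarrow> complexify f 0 = 0"
  by (simp add: complexify_def complex_eq_iff linear_0)

lemma complexify_scale:
  "linear f \<Longrightarrow> complexify f (complex_scale c x) = c * complex_of_real (f x)"
  by (simp add: complexify_def complex_scale_def complex_eq_iff linear_scale)

lemma complexify_sum:
  assumes "linear f"
  shows "complexify f (\<Sum>i\<in>I. g i) = (\<Sum>i\<in>I. complexify f (g i))"
  by (induction I rule: infinite_finite_induct)
    (auto simp: complexify_add[OF assms] complexify_0[OF assms])

section \<open>Index sets of maximal cones and their faces\<close>

locale fan =
  fixes \<Sigma> :: "(real ^ 'n) set set" and Q :: "(real ^ 'n) set"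
    and d :: nat and v :: "nat \<Rightarrow> real ^ 'n"
  assumes triple: "fan_triple \<Sigma> Q d v"
begin

text \<open>Stands in for \<open>max_index\<close> and \<open>face_index\<close>: membership of
  \<open>v i\<close> depends on the cone alone, not on a surrounding maximal cone, and is compatible
  with intersections.\<close>

definition idx :: "(real ^ 'n) set \<Rightarrow> nat set" where
  "idx \<rho> = {i \<in> {1..d}. v i \<in> \<rho>}"

lemma idx_Int: "idx (\<delta> \<inter> \<gamma>) = idx \<delta> \<inter> idx \<gamma>"
  by (auto simp: idx_def)

lemma finite_idx: "finite (idx \<rho>)"
  by (auto simp: idx_def)

lemma ray_bij: "bij_betw (\<lambda>i. cone_gen {v i}) {1..d} (fan_rays \<Sigma>)"
  using triple by (simp add: fan_triple_def)

lemma ray_in_fan: "i \<in> {1..d} \<Longrightarrow> cone_gen {v i} \<in> \<Sigma>"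
  using ray_bij by (auto simp: bij_betw_def fan_rays_def)

lemma ray_nonzero:
  assumes "i \<in> {1..d}"
  shows "v i \<noteq> 0"
proof
  assume "v i = 0"
  then have "cone_gen {v i} = {0}" by (auto simp: cone_gen_singleton)
  moreover have "dim (cone_gen {v i}) = 1"
    using ray_bij assms by (auto simp: bij_betw_def fan_rays_def)
  ultimately show False by simp
qed

lemma fan_face: "\<sigma> \<in> \<Sigma> \<Longrightarrow> cone_face \<delta> \<sigma> \<Longrightarrow> \<delta> \<in> \<Sigma>"
  using triple unfolding fan_triple_def simplicial_fan_def by blast

lemma fan_Int_face: "\<sigma> \<in> \<Sigma> \<Longrightarrow> \<tau> \<in> \<Sigma> \<Longrightarrow> cone_face (\<sigma> \<inter> \<tau>) \<sigma>"
  using triple unfolding fan_triple_def simplicial_fan_def by blast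

text \<open>Each \<open>s\<close> in \<open>S\<close> generates a ray of the fan, which surjectivity
  of the ray bijection matches with the ray of some \<open>v (f s)\<close>. Conversely, injectivity
  shows that every index in \<open>idx \<sigma>\<close> arises as some \<open>f s\<close>.\<close>

lemma generators_idx:
  assumes "\<sigma> \<in> \<Sigma>" "independent S" "\<sigma> = cone_gen S"
  shows "card (idx \<sigma>) \<le> card S" "cone_gen (v ` idx \<sigma>) = \<sigma>"
proof -
  have fin: "finite S" using assms(2) by (rule independent_imp_finite)
  have nz: "s \<noteq> 0" if "s \<in> S" for s
    using that assms(2) dependent_zero by blast
  have "\<exists>i\<in>{1..d}. cone_gen {v i} = cone_gen {s}" if s: "s \<in> S" for s
  proof -
    have "cone_face (cone_gen {s}) \<sigma>"
      unfolding cone_face_def using assms s by (intro exI[of _ S] exI[of _ "{s}"]) auto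
    then have "cone_gen {s} \<in> \<Sigma>" using assms(1) fan_face by blast
    moreover have "dim (cone_gen {s}) = 1"
      using nz[OF s] dim_cone_gen[of "{s}"] by simp
    ultimately have "cone_gen {s} \<in> fan_rays \<Sigma>" by (simp add: fan_rays_def)
    then have "cone_gen {s} \<in> (\<lambda>i. cone_gen {v i}) ` {1..d}"
      by (simp only: bij_betw_imp_surj_on[OF ray_bij])
    then show ?thesis by (elim imageE) (rule bexI, rule sym)
  qed
  then obtain f where f: "f s \<in> {1..d}" "cone_gen {v (f s)} = cone_gen {s}" if "s \<in> S" for s
    by metis
  have "idx \<sigma> \<subseteq> f ` S"
  proof
    fix i assume "i \<in> idx \<sigma>"
    then have i: "i \<in> {1..d}" "v i \<in> \<sigma>" by (auto simp: idx_def)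
    have "cone_gen {v i} \<subseteq> \<sigma>"
      using i unfolding assms(3) by (intro cone_gen_minimal convex_cone_cone_gen) auto
    \<comment> \<open>The ray meets \<open>\<sigma>\<close> in the ray itself, so the fan axiom on
      intersections makes it a face.\<close>
    then have "cone_face (cone_gen {v i}) \<sigma>"
      using fan_Int_face[OF assms(1) ray_in_fan[OF i(1)]] by (simp add: Int_absorb1)
    then have eq: "cone_gen {v i} = cone_gen (S \<inter> cone_gen {v i})"
      using cone_face_extremal extremal_subcone_generators fin assms(3) by blast
    have "S \<inter> cone_gen {v i} \<noteq> {}"
    proof
      assume "S \<inter> cone_gen {v i} = {}"
      then have "cone_gen {v i} = cone_gen {}" using eq by argo
      then have "cone_gen {v i} = {0}" by (simp add: cone_gen_def)
      then show False
        using generator_in_cone_gen[of "{v i}" "v i"] ray_nonzero[OF i(1)] by auto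
    qed
    then obtain s where s: "s \<in> S" "s \<in> cone_gen {v i}" by blast
    then obtain c where c: "c \<ge> 0" "s = c *\<^sub>R v i" by (auto simp: cone_gen_singleton)
    with nz[OF s(1)] have "c > 0" by (cases "c = 0") auto
    then have "cone_gen {v (f s)} = cone_gen {v i}"
      using f(2)[OF s(1)] c cone_gen_singleton_scale[of c "v i"] by simp
    then have "f s = i"
      by (rule inj_onD[OF bij_betw_imp_inj_on[OF ray_bij] _ f(1)[OF s(1)] i(1)])
    with s show "i \<in> f ` S" by blast
  qed
  then show "card (idx \<sigma>) \<le> card S"
    by (rule surj_card_le[OF fin])
  have "s \<in> cone_gen (v ` idx \<sigma>)" if s: "s \<in> S" for s
  proof -
    have fs: "v (f s) \<in> cone_gen {s}" "s \<in> cone_gen {v (f s)}"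
      using f(2)[OF s] generator_in_cone_gen[of "{_}"] by auto
    have "v (f s) \<in> \<sigma>"
      using fs(1) cone_gen_minimal[OF convex_cone_cone_gen, of "{s}" S] generator_in_cone_gen[OF fin s]
      unfolding assms(3) by blast
    then have "f s \<in> idx \<sigma>" using f(1)[OF s] by (simp add: idx_def)
    then have "v (f s) \<in> cone_gen (v ` idx \<sigma>)"
      using finite_idx by (intro generator_in_cone_gen) auto
    then show ?thesis
      using fs(2) cone_gen_minimal[OF convex_cone_cone_gen, of "{v (f s)}" "v ` idx \<sigma>"] by blast
  qed
  then have "\<sigma> \<subseteq> cone_gen (v ` idx \<sigma>)"
    unfolding assms(3) by (intro cone_gen_minimal convex_cone_cone_gen) auto
  moreover have "cone_gen (v ` idx \<sigma>) \<subseteq> \<sigma>"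
    using convex_cone_cone_gen[of S] assms(3) by (intro cone_gen_minimal) (auto simp: idx_def)
  ultimately show "cone_gen (v ` idx \<sigma>) = \<sigma>" by blast
qed

context
  fixes \<sigma>
  assumes max: "maximal_cone \<Sigma> \<sigma>"
begin

text \<open>The dimension is at most the number of vectors \<open>v i\<close> in
  \<open>\<sigma>\<close>, which is at most the number of their indices, which by
  \<open>generators_idx\<close> is at most the dimension. Equality throughout yields injectivity and
  independence.\<close>

lemma
  shows cone_gen_idx: "cone_gen (v ` idx \<sigma>) = \<sigma>"
    and card_idx: "card (idx \<sigma>) = CARD('n)"
    and inj_on_idx: "inj_on v (idx \<sigma>)"
    and independent_idx: "independent (v ` idx \<sigma>)"
    and span_idx: "span (v ` idx \<sigma>) = UNIV"
proof -
  have \<sigma>: "\<sigma> \<in> \<Sigma>" "dim \<sigma> = CARD('n)"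
    using max by (auto simp: maximal_cone_def)
  then obtain S where S: "independent S" "\<sigma> = cone_gen S"
    using triple unfolding fan_triple_def simplicial_fan_def simplicial_cone_def by blast
  have cS: "card S = CARD('n)" using dim_cone_gen[OF S(1)] S(2) \<sigma>(2) by simp
  show gen: "cone_gen (v ` idx \<sigma>) = \<sigma>"
    using generators_idx(2) \<sigma> S by blast
  have le: "card (idx \<sigma>) \<le> CARD('n)"
    using generators_idx(1)[OF \<sigma>(1) S] cS by simp
  have dim: "dim (v ` idx \<sigma>) = CARD('n)"
    using \<sigma>(2) gen span_cone_gen[of "v ` idx \<sigma>"] finite_idx by (metis dim_span finite_imageI)
  have "dim (v ` idx \<sigma>) \<le> card (v ` idx \<sigma>)"
    using finite_idx by (intro dim_le_card') auto
  moreover have "card (v ` idx \<sigma>) \<le> card (idx \<sigma>)"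
    using finite_idx by (rule card_image_le)
  ultimately have eq: "card (v ` idx \<sigma>) = CARD('n)" "card (idx \<sigma>) = CARD('n)"
    using dim le by auto
  then show "card (idx \<sigma>) = CARD('n)" by simp
  show "inj_on v (idx \<sigma>)"
    using eq finite_idx by (intro eq_card_imp_inj_on) auto
  show "independent (v ` idx \<sigma>)"
    using eq dim finite_idx by (intro card_le_dim_spanning[of _ "span (v ` idx \<sigma>)"]) (auto intro: span_base)
  show "span (v ` idx \<sigma>) = UNIV"
    using dim by (simp add: dim_eq_full[symmetric])
qed

text \<open>Any competing \<open>I\<close> consists of indices of vectors in
  \<open>\<sigma>\<close>, so it is contained in \<open>idx \<sigma>\<close> and has the same
  size.\<close>

lemma max_index_eq: "max_index d v \<sigma> = idx \<sigma>"
  unfolding max_index_def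
proof (rule the_equality)
  show "idx \<sigma> \<subseteq> {1..d} \<and> card (idx \<sigma>) = CARD('n) \<and> \<sigma> = cone_gen (v ` idx \<sigma>)"
    using card_idx cone_gen_idx by (auto simp: idx_def)
  fix I assume I: "I \<subseteq> {1..d} \<and> card I = CARD('n) \<and> \<sigma> = cone_gen (v ` I)"
  then have "finite I" using finite_subset by blast
  then have "I \<subseteq> idx \<sigma>"
    using I by (auto simp: idx_def intro!: generator_in_cone_gen)
  then show "I = idx \<sigma>"
    using I card_idx finite_idx by (metis card_subset_eq)
qed

text \<open>Existence applies \<open>extremal_subcone_generators\<close> to the ray vectors of
  \<open>\<sigma>\<close>; uniqueness follows from independence and injectivity. Stated for
  \<open>extremal_subcone\<close>, it covers the intersections
  \<open>\<delta> \<inter> \<gamma>\<close> directly.\<close>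

lemma face_index_eq:
  assumes "extremal_subcone \<rho> \<sigma>"
  shows "face_index d v \<sigma> \<rho> = idx \<rho>"
  unfolding face_index_def max_index_eq
proof (rule the_equality)
  have sub: "idx \<rho> \<subseteq> idx \<sigma>" using assms by (auto simp: extremal_subcone_def idx_def)
  have "v ` idx \<sigma> \<inter> \<rho> = v ` idx \<rho>"
    using sub by (auto simp: idx_def)
  then have gen: "\<rho> = cone_gen (v ` idx \<rho>)"
    using extremal_subcone_generators[of "v ` idx \<sigma>" \<rho>] assms cone_gen_idx finite_idx by simp
  show "idx \<rho> \<subseteq> idx \<sigma> \<and> \<rho> = cone_gen (v ` idx \<rho>)"
    using sub gen by blast
  fix J assume J: "J \<subseteq> idx \<sigma> \<and> \<rho> = cone_gen (v ` J)"
  then have fin: "finite J" using finite_idx finite_subset by blast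
  show "J = idx \<rho>"
  proof
    show "J \<subseteq> idx \<rho>"
      using J fin by (auto simp: idx_def intro!: generator_in_cone_gen)
    show "idx \<rho> \<subseteq> J"
    proof
      fix i assume i: "i \<in> idx \<rho>"
      then have "v i \<in> cone_gen (v ` J)" using J by (simp add: idx_def)
      then have "v i \<in> v ` J"
        using independent_generator_in_subcone[OF independent_idx, of "v ` J" "v i"] J i sub by blast
      then show "i \<in> J"
        using inj_on_idx J i sub by (auto simp: inj_on_def)
    qed
  qed
qed

section \<open>Dual bases\<close>

text \<open>Independence gives existence of the functional, spanning its uniqueness. For
  \<open>i\<close> outside \<open>idx \<sigma>\<close> the description yields the zero functional,
  so \<open>i\<close> can stay arbitrary.\<close>

lemma linear_dual_basis: "linear (dual_basis d v \<sigma> i)"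
  and dual_basis_generator:
    "j \<in> idx \<sigma> \<Longrightarrow> dual_basis d v \<sigma> i (v j) = (if j = i then 1 else 0)"
proof -
  let ?P = "\<lambda>f. linear f \<and> (\<forall>j\<in>idx \<sigma>. f (v j) = (if j = i then 1 else 0 :: real))"
  \<comment> \<open>Values are prescribed on vectors, so \<open>inv_into\<close> recovers the index;
    injectivity of \<open>v\<close> makes this consistent.\<close>
  obtain g :: "real ^ 'n \<Rightarrow> real" where g: "linear g"
    "\<forall>x\<in>v ` idx \<sigma>. g x = (if inv_into (idx \<sigma>) v x = i then 1 else 0)"
    using linear_independent_extend[OF independent_idx,
        of "\<lambda>x. if inv_into (idx \<sigma>) v x = i then 1 else 0"] by auto
  have "?P g" using g inj_on_idx by auto
  moreover have "f = g" if "?P f" for f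
  proof
    fix x
    show "f x = g x"
      using that g \<open>?P g\<close> span_idx by (intro linear_eq_on_span[of f g "v ` idx \<sigma>" x]) auto
  qed
  ultimately have "?P (dual_basis d v \<sigma> i)"
    unfolding dual_basis_def max_index_eq by (rule theI)
  then show "linear (dual_basis d v \<sigma> i)"
    "j \<in> idx \<sigma> \<Longrightarrow> dual_basis d v \<sigma> i (v j) = (if j = i then 1 else 0)"
    by auto
qed

lemma dual_basis_expansion: "(\<Sum>i\<in>idx \<sigma>. dual_basis d v \<sigma> i x *\<^sub>R v i) = x"
proof -
  let ?h = "\<lambda>x. \<Sum>i\<in>idx \<sigma>. dual_basis d v \<sigma> i x *\<^sub>R v i"
  have "linear ?h"
    by (intro linearI) (simp_all add: linear_add[OF linear_dual_basis] linear_scale[OF linear_dual_basis]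
        scaleR_add_left sum.distrib scaleR_sum_right)
  moreover have "?h (v j) = v j" if "j \<in> idx \<sigma>" for j
    using that finite_idx
    by (simp add: dual_basis_generator if_distrib[of "\<lambda>c. c *\<^sub>R _"] cong: if_cong)
  ultimately show ?thesis
    using span_idx linear_eq_on_span[of ?h "\<lambda>x. x" "v ` idx \<sigma>" x] by (auto simp: linear_id[unfolded id_def])
qed

text \<open>This integrality makes the action of a coset in \<open>cone_group\<close> independent of
  the representative.\<close>

lemma dual_basis_int_span:
  assumes "h \<in> int_span (v ` idx \<sigma>)"
  shows "dual_basis d v \<sigma> i h \<in> \<int>"
proof -
  obtain T c where T: "finite T" "T \<subseteq> v ` idx \<sigma>" and h: "h = (\<Sum>u\<in>T. of_int (c u) *\<^sub>R u)"
    using assms by (auto simp: int_span_def)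
  have "dual_basis d v \<sigma> i h = (\<Sum>u\<in>T. of_int (c u) * dual_basis d v \<sigma> i u)"
    by (simp add: h linear_sum[OF linear_dual_basis] linear_scale[OF linear_dual_basis])
  also have "\<dots> \<in> \<int>"
    using T by (intro Ints_sum Ints_mult) (auto simp: dual_basis_generator)
  finally show ?thesis .
qed

lemma complexify_expansion:
  "(\<Sum>i\<in>idx \<sigma>. complex_scale (complexify (dual_basis d v \<sigma> i) \<xi>) (v i)) = \<xi>"
  by (simp add: prod_eq_iff fst_sum snd_sum complex_scale_def complexify_def dual_basis_expansion)

end

section \<open>Points of the charts in exponential coordinates\<close>

text \<open>The pair \<open>(Z, \<xi>)\<close> of a vanishing set and a logarithm \<open>\<xi> \<in> \<complex>\<^sup>n\<close> names a point in every chart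
  whose cone contains the rays in \<open>Z\<close>; the transition maps preserve this name.\<close>

definition point :: "(real ^ 'n) set \<Rightarrow> nat set \<Rightarrow> (real ^ 'n) \<times> (real ^ 'n) \<Rightarrow> nat \<Rightarrow> complex" where
  "point \<sigma> Z \<xi> =
     (\<lambda>i\<in>idx \<sigma>. if i \<in> Z then 0 else unit_exp (complexify (dual_basis d v \<sigma> i) \<xi>))"

text \<open>The orbit of \<open>point \<sigma> Z \<xi>\<close>, as \<open>orbit_point\<close>
  confirms. An element \<open>u\<close> of \<open>Q\<close> acts by a real translation of the
  logarithm, and this translation is the same for every \<open>\<sigma>\<close>.\<close>

definition chart_point ::
  "(real ^ 'n) set \<Rightarrow> nat set \<Rightarrow> (real ^ 'n) \<times> (real ^ 'n) \<Rightarrow> (nat \<Rightarrow> complex) set" where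
  "chart_point \<sigma> Z \<xi> = (\<lambda>u. point \<sigma> Z (\<xi> + (u, 0))) ` Q"

lemma Q_add: "x \<in> Q \<Longrightarrow> y \<in> Q \<Longrightarrow> x + y \<in> Q"
  and Q_scale: "x \<in> Q \<Longrightarrow> of_int m *\<^sub>R x \<in> Q"
  and Q_0: "0 \<in> Q"
  using triple unfolding fan_triple_def quasilattice_def
  by (auto intro: int_span_add int_span_scale int_span_0)

lemma Q_diff: "x \<in> Q \<Longrightarrow> y \<in> Q \<Longrightarrow> x - y \<in> Q"
  using Q_add[of x "- y"] Q_scale[of y "-1"] by simp

lemma Q_generator: "i \<in> idx \<sigma> \<Longrightarrow> v i \<in> Q"
  using triple by (auto simp: fan_triple_def idx_def)

lemma Q_sum: "(\<And>i. i \<in> I \<Longrightarrow> f i \<in> Q) \<Longrightarrow> sum f I \<in> Q"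
  by (induction I rule: infinite_finite_induct) (auto simp: Q_0 Q_add)

text \<open>\<open>Q\<close> is a group, so translation by \<open>u\<close> merely reindexes the
  orbit.\<close>

lemma chart_point_translate:
  assumes "u \<in> Q"
  shows "chart_point \<sigma> Z (\<xi> + (u, 0)) = chart_point \<sigma> Z \<xi>"
proof
  have eq: "\<xi> + (u, 0) + (w, 0) = \<xi> + (u + w, 0)" for w
    by (simp add: add.assoc)
  show "chart_point \<sigma> Z (\<xi> + (u, 0)) \<subseteq> chart_point \<sigma> Z \<xi>"
    unfolding chart_point_def eq using assms Q_add by auto
  show "chart_point \<sigma> Z \<xi> \<subseteq> chart_point \<sigma> Z (\<xi> + (u, 0))"
  proof
    fix z assume "z \<in> chart_point \<sigma> Z \<xi>"
    then obtain w where w: "w \<in> Q" "z = point \<sigma> Z (\<xi> + (w, 0))"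
      by (auto simp: chart_point_def)
    then have "z = point \<sigma> Z (\<xi> + (u, 0) + (w - u, 0))" by (simp add: eq)
    then show "z \<in> chart_point \<sigma> Z (\<xi> + (u, 0))"
      unfolding chart_point_def using Q_diff[OF w(1) assms] by blast
  qed
qed

lemma point_in_chart_point: "point \<sigma> Z \<xi> \<in> chart_point \<sigma> Z \<xi>"
proof -
  have "point \<sigma> Z \<xi> = point \<sigma> Z (\<xi> + (0, 0))" by (simp add: zero_prod_def[symmetric])
  then show ?thesis unfolding chart_point_def using Q_0 by blast
qed

text \<open>\<open>unit_exp\<close> never vanishes, so \<open>Z\<close> can be read off from the
  point.\<close>

lemma point_zero_iff: "i \<in> idx \<sigma> \<Longrightarrow> point \<sigma> Z \<xi> i = 0 \<longleftrightarrow> i \<in> Z"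
  by (simp add: point_def)

lemma point_eq_zero_set:
  assumes "point \<sigma> Z \<xi> = point \<sigma> Z' \<xi>'" "Z \<subseteq> idx \<sigma>" "Z' \<subseteq> idx \<sigma>"
  shows "Z = Z'"
  using assms point_zero_iff by (metis subsetD subsetI subset_antisym)

text \<open>Two logarithms of a point differ by an integral combination of the generators, which lies
  in \<open>Q\<close>, and by a complex combination of the generators indexed by \<open>Z\<close>, which no chart
  containing these rays sees.\<close>

lemma point_eq_change_cone:
  assumes "maximal_cone \<Sigma> \<sigma>" "maximal_cone \<Sigma> \<tau>" "Z \<subseteq> idx \<sigma>" "Z \<subseteq> idx \<tau>"
    and eq: "point \<sigma> Z \<xi> = point \<sigma> Z \<xi>'"
  shows "chart_point \<tau> Z \<xi> = chart_point \<tau> Z \<xi>'"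
proof -
  let ?a = "\<lambda>i. complexify (dual_basis d v \<sigma> i)"
  have "\<exists>m::int. ?a i \<xi> = ?a i \<xi>' + of_int m" if "i \<in> idx \<sigma> - Z" for i
    using fun_cong[OF eq, of i] that by (simp add: point_def unit_exp_eq_iff)
  then obtain m :: "nat \<Rightarrow> int" where m: "?a i \<xi> = ?a i \<xi>' + of_int (m i)" if "i \<in> idx \<sigma> - Z" for i
    by metis
  define u where "u = (\<Sum>i\<in>idx \<sigma> - Z. of_int (m i) *\<^sub>R v i)"
  have u: "u \<in> Q"
    unfolding u_def by (intro Q_sum Q_scale Q_generator) auto
  have "complexify (dual_basis d v \<tau> j) \<xi> = complexify (dual_basis d v \<tau> j) (\<xi>' + (u, 0))"
    if j: "j \<in> idx \<tau> - Z" for j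
  proof -
    let ?b = "dual_basis d v \<tau> j"
    have lin: "linear ?b" using assms(2) by (rule linear_dual_basis)
    \<comment> \<open>The inclusion of \<open>Z\<close> in \<open>idx \<tau>\<close> enters here:
      \<open>v i\<close> is a generator of \<open>\<tau>\<close> other than
      \<open>v j\<close>.\<close>
    have zero: "?b (v i) = 0" if "i \<in> Z" for i
      using that j assms(4) dual_basis_generator[OF assms(2), of i j] by auto
    have expand: "complexify ?b \<zeta> = (\<Sum>i\<in>idx \<sigma> - Z. ?a i \<zeta> * complex_of_real (?b (v i)))" for \<zeta>
    proof -
      have "complexify ?b \<zeta> = complexify ?b (\<Sum>i\<in>idx \<sigma>. complex_scale (?a i \<zeta>) (v i))"
        using complexify_expansion[OF assms(1)] by simp
      also have "\<dots> = (\<Sum>i\<in>idx \<sigma>. ?a i \<zeta> * complex_of_real (?b (v i)))"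
        by (simp add: complexify_sum[OF lin] complexify_scale[OF lin])
      also have "\<dots> = (\<Sum>i\<in>idx \<sigma> - Z. ?a i \<zeta> * complex_of_real (?b (v i)))"
        using finite_idx zero by (intro sum.mono_neutral_right) auto
      finally show ?thesis .
    qed
    have "complexify ?b \<xi> = (\<Sum>i\<in>idx \<sigma> - Z. (?a i \<xi>' + of_int (m i)) * complex_of_real (?b (v i)))"
      unfolding expand using m by (intro sum.cong) auto
    also have "\<dots> = complexify ?b \<xi>' + (\<Sum>i\<in>idx \<sigma> - Z. of_int (m i) * complex_of_real (?b (v i)))"
      unfolding expand[of \<xi>'] by (simp add: distrib_right sum.distrib)
    also have "(\<Sum>i\<in>idx \<sigma> - Z. of_int (m i) * complex_of_real (?b (v i))) = complexify ?b (u, 0)"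
      by (simp add: complexify_real[OF lin] u_def linear_sum[OF lin] linear_scale[OF lin])
    finally show ?thesis by (simp add: complexify_add[OF lin])
  qed
  then have shift: "point \<tau> Z (\<xi> + (w, 0)) = point \<tau> Z (\<xi>' + (u, 0) + (w, 0))" for w
    unfolding point_def using linear_dual_basis[OF assms(2)]
    by (intro restrict_ext) (simp add: complexify_add)
  have "chart_point \<tau> Z \<xi> = chart_point \<tau> Z (\<xi>' + (u, 0))"
    unfolding chart_point_def shift ..
  then show ?thesis using chart_point_translate[OF u] by simp
qed

text \<open>Equal orbits share a point after a translation by some \<open>u\<close> in
  \<open>Q\<close>; its zeros determine \<open>Z\<close>, and \<open>point_eq_change_cone\<close>
  carries the equality over to \<open>\<tau>\<close>.\<close>

lemma chart_point_eqD:
  assumes "maximal_cone \<Sigma> \<sigma>" "Z \<subseteq> idx \<sigma>" "Z' \<subseteq> idx \<sigma>"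
    and eq: "chart_point \<sigma> Z \<xi> = chart_point \<sigma> Z' \<xi>'"
  shows "Z = Z'"
    and "maximal_cone \<Sigma> \<tau> \<Longrightarrow> Z \<subseteq> idx \<tau> \<Longrightarrow> chart_point \<tau> Z \<xi> = chart_point \<tau> Z' \<xi>'"
proof -
  have "point \<sigma> Z \<xi> \<in> chart_point \<sigma> Z' \<xi>'"
    using point_in_chart_point eq by blast
  then obtain u where u: "u \<in> Q" "point \<sigma> Z \<xi> = point \<sigma> Z' (\<xi>' + (u, 0))"
    by (auto simp: chart_point_def)
  show Z: "Z = Z'"
    by (rule point_eq_zero_set[OF u(2) assms(2,3)])
  assume \<tau>: "maximal_cone \<Sigma> \<tau>" "Z \<subseteq> idx \<tau>"
  have "chart_point \<tau> Z \<xi> = chart_point \<tau> Z (\<xi>' + (u, 0))"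
    by (rule point_eq_change_cone[OF assms(1) \<tau>(1) assms(2) \<tau>(2) u(2)[folded Z]])
  then show "chart_point \<tau> Z \<xi> = chart_point \<tau> Z' \<xi>'"
    using chart_point_translate[OF u(1)] Z by simp
qed

section \<open>The group action and its orbits\<close>

lemma carrier_cone_group:
  assumes "maximal_cone \<Sigma> \<sigma>"
  shows "carrier (cone_group d v Q \<sigma>) = (\<lambda>u. (\<lambda>h. h + u) ` int_span (v ` idx \<sigma>)) ` Q"
  unfolding cone_group_def FactGroup_def RCOSETS_def r_coset_def add_monoid_on_def
    max_index_eq[OF assms] by auto

text \<open>Two representatives of a coset differ by some \<open>h\<close> on which the dual
  functionals are integral, so they give the same factors and the definite description has a single
  candidate.\<close>

lemma cone_act_coset:
  assumes "maximal_cone \<Sigma> \<sigma>"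
  shows "cone_act d v \<sigma> ((\<lambda>h. h + u) ` int_span (v ` idx \<sigma>)) z =
    (\<lambda>i\<in>idx \<sigma>. unit_exp (complex_of_real (dual_basis d v \<sigma> i u)) * z i)"
proof -
  let ?w = "\<lambda>u. \<lambda>i\<in>idx \<sigma>. unit_exp (complex_of_real (dual_basis d v \<sigma> i u)) * z i"
  have shift: "?w (h + u) = ?w u" if h: "h \<in> int_span (v ` idx \<sigma>)" for h
  proof (rule restrict_ext)
    fix i
    obtain m :: int where "dual_basis d v \<sigma> i h = of_int m"
      using dual_basis_int_span[OF assms h] by (auto elim: Ints_cases)
    then show "unit_exp (complex_of_real (dual_basis d v \<sigma> i (h + u))) * z i =
        unit_exp (complex_of_real (dual_basis d v \<sigma> i u)) * z i"
      by (simp add: linear_add[OF linear_dual_basis[OF assms]] unit_exp_add unit_exp_of_int)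
  qed
  have "(THE w. \<exists>u'\<in>(\<lambda>h. h + u) ` int_span (v ` idx \<sigma>). w = ?w u') = ?w u"
  proof (rule the_equality)
    show "\<exists>u'\<in>(\<lambda>h. h + u) ` int_span (v ` idx \<sigma>). ?w u = ?w u'"
      using int_span_0 by (intro bexI[of _ u] image_eqI[of _ _ 0]) auto
  qed (auto simp: shift)
  then show ?thesis
    unfolding cone_act_def max_index_eq[OF assms] unit_exp_def .
qed

text \<open>The exponent absorbs the factor of the action as a real translation by \<open>u\<close>,
  while vanishing coordinates remain 0.\<close>

lemma orbit_point:
  assumes "maximal_cone \<Sigma> \<sigma>"
  shows "orbit (cone_group d v Q \<sigma>) (cone_act d v \<sigma>) (point \<sigma> Z \<xi>) = chart_point \<sigma> Z \<xi>"
proof -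
  have "(\<lambda>i\<in>idx \<sigma>. unit_exp (complex_of_real (dual_basis d v \<sigma> i u)) * point \<sigma> Z \<xi> i) =
      point \<sigma> Z (\<xi> + (u, 0))" for u
    unfolding point_def using linear_dual_basis[OF assms]
    by (intro restrict_ext) (simp add: complexify_add complexify_real unit_exp_add)
  moreover have "orbit (cone_group d v Q \<sigma>) (cone_act d v \<sigma>) z =
      (\<lambda>g. cone_act d v \<sigma> g z) ` carrier (cone_group d v Q \<sigma>)" for z
    by (auto simp: orbit_def)
  ultimately show ?thesis
    by (simp add: carrier_cone_group[OF assms] chart_point_def image_image cone_act_coset[OF assms])
qed

text \<open>The dual functional of index \<open>i\<close> picks out \<open>x i\<close> from the sum.
  Terms with \<open>k\<close> in \<open>Z\<close> are omitted, since \<open>log_choice\<close>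
  leaves \<open>x k\<close> arbitrary when \<open>z k\<close> is 0.\<close>

lemma point_of_logs:
  assumes "maximal_cone \<Sigma> \<sigma>" "z \<in> extensional (idx \<sigma>)" "log_choice (idx \<sigma>) z x"
    and "Z = {i \<in> idx \<sigma>. z i = 0}"
  shows "z = point \<sigma> Z (\<Sum>k\<in>idx \<sigma> - Z. complex_scale (x k) (v k))"
proof (rule extensionalityI[OF assms(2)])
  show "point \<sigma> Z \<xi> \<in> extensional (idx \<sigma>)" for \<xi> by (simp add: point_def)
  fix i assume i: "i \<in> idx \<sigma>"
  let ?a = "dual_basis d v \<sigma> i"
  have lin: "linear ?a" using assms(1) by (rule linear_dual_basis)
  show "z i = point \<sigma> Z (\<Sum>k\<in>idx \<sigma> - Z. complex_scale (x k) (v k)) i"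
  proof (cases "i \<in> Z")
    case False
    have "complexify ?a (\<Sum>k\<in>idx \<sigma> - Z. complex_scale (x k) (v k)) =
        (\<Sum>k\<in>idx \<sigma> - Z. if k = i then x k else 0)"
      using dual_basis_generator[OF assms(1)]
      by (auto simp: complexify_sum[OF lin] complexify_scale[OF lin] intro!: sum.cong)
    also have "\<dots> = x i" using i False finite_idx by simp
    finally show ?thesis
      using i False assms(3,4) by (simp add: point_def log_choice_def unit_exp_def)
  qed (use i assms(4) in \<open>simp add: point_def\<close>)
qed

lemma log_choice_exists: "\<exists>x. log_choice I z x"
proof -
  have "\<exists>x. z k \<noteq> 0 \<longrightarrow> z k = unit_exp x" for k
    using unit_exp_surj by metis
  then obtain x where "\<And>k. z k \<noteq> 0 \<longrightarrow> z k = unit_exp (x k)" by metis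
  then show ?thesis unfolding log_choice_def unit_exp_def by blast
qed

text \<open>The face enters a chart only through the admissible zero sets; logarithms of the nonzero
  coordinates turn every vector of the domain into some
  \<open>point \<sigma> Z \<xi>\<close>.\<close>

lemma chart_eq:
  assumes "maximal_cone \<Sigma> \<sigma>" "extremal_subcone \<rho> \<sigma>"
  shows "chart d v Q \<sigma> \<rho> = {chart_point \<sigma> Z \<xi> | Z \<xi>. Z \<subseteq> idx \<rho>}"
proof -
  have sub: "idx \<rho> \<subseteq> idx \<sigma>" using assms(2) by (auto simp: extremal_subcone_def idx_def)
  have "chart_dom d v \<sigma> \<rho> = {point \<sigma> Z \<xi> | Z \<xi>. Z \<subseteq> idx \<rho>}"
  proof (intro equalityI subsetI)
    fix z assume "z \<in> chart_dom d v \<sigma> \<rho>"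
    then have z: "z \<in> extensional (idx \<sigma>)" "\<forall>i\<in>idx \<sigma> - idx \<rho>. z i \<noteq> 0"
      by (auto simp: chart_dom_def max_index_eq[OF assms(1)] face_index_eq[OF assms] PiE_def)
    define Z where "Z = {i \<in> idx \<sigma>. z i = 0}"
    obtain x where "log_choice (idx \<sigma>) z x" using log_choice_exists by blast
    then have "\<exists>\<xi>. z = point \<sigma> Z \<xi>" using point_of_logs[OF assms(1) z(1) _ Z_def] by blast
    moreover have "Z \<subseteq> idx \<rho>" using z(2) by (auto simp: Z_def)
    ultimately show "z \<in> {point \<sigma> Z \<xi> | Z \<xi>. Z \<subseteq> idx \<rho>}" by blast
  next
    fix z assume "z \<in> {point \<sigma> Z \<xi> | Z \<xi>. Z \<subseteq> idx \<rho>}"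
    then show "z \<in> chart_dom d v \<sigma> \<rho>"
      by (auto simp: chart_dom_def max_index_eq[OF assms(1)] face_index_eq[OF assms]
          point_def PiE_def split: if_splits)
  qed
  then have "chart d v Q \<sigma> \<rho> = {orbit (cone_group d v Q \<sigma>) (cone_act d v \<sigma>) (point \<sigma> Z \<xi>)
      | Z \<xi>. Z \<subseteq> idx \<rho>}"
    unfolding chart_def orbits_def by auto
  then show ?thesis by (simp only: orbit_point[OF assms(1)])
qed

section \<open>Transition maps\<close>

text \<open>Real powers multiply logarithms, so the monomials evaluate the dual functionals of
  \<open>\<tau>\<close> at the vector \<open>\<xi>'\<close> built from \<open>x\<close>. It may
  differ from \<open>\<xi>\<close>, but both name the same point over \<open>\<sigma>\<close>, hence
  the same orbit over \<open>\<tau>\<close>.\<close>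

lemma monomial_map_point:
  assumes "maximal_cone \<Sigma> \<sigma>" "maximal_cone \<Sigma> \<tau>" "Z \<subseteq> idx \<sigma>" "Z \<subseteq> idx \<tau>"
    and "log_choice (idx \<sigma>) (point \<sigma> Z \<xi>) x"
  shows "orbit (cone_group d v Q \<tau>) (cone_act d v \<tau>) (monomial_map d v \<sigma> \<tau> (point \<sigma> Z \<xi>) x) =
    chart_point \<tau> Z \<xi>"
proof -
  let ?z = "point \<sigma> Z \<xi>"
  define \<xi>' where "\<xi>' = (\<Sum>k\<in>idx \<sigma> - Z. complex_scale (x k) (v k))"
  have "Z = {i \<in> idx \<sigma>. ?z i = 0}"
    using assms(3) by (auto simp: point_def split: if_splits)
  then have z: "?z = point \<sigma> Z \<xi>'"
    unfolding \<xi>'_def using assms(1,5) by (intro point_of_logs) (auto simp: point_def)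
  have "monomial_map d v \<sigma> \<tau> ?z x = point \<tau> Z \<xi>'"
    unfolding monomial_map_def point_def[of \<tau>] max_index_eq[OF assms(1)] max_index_eq[OF assms(2)]
  proof (rule restrict_ext)
    fix i assume i: "i \<in> idx \<tau>"
    let ?b = "dual_basis d v \<tau> i"
    have lin: "linear ?b" using assms(2) by (rule linear_dual_basis)
    show "(\<Prod>k\<in>idx \<sigma>. log_power (?z k) (x k) (?b (v k))) =
        (if i \<in> Z then 0 else unit_exp (complexify ?b \<xi>'))"
    proof (cases "i \<in> Z")
      case True
      \<comment> \<open>The factor \<open>k = i\<close> has base 0 and exponent 1, so the product
        vanishes.\<close>
      then have "log_power (?z i) (x i) (?b (v i)) = 0"
        using i assms(3) by (auto simp: log_power_def point_def dual_basis_generator[OF assms(2)])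
      then show ?thesis
        using True assms(3) finite_idx by (auto intro!: prod_zero)
    next
      case False
      \<comment> \<open>For \<open>k\<close> in \<open>Z\<close> the base is 0 and the exponent is 0
        as well, because \<open>v k\<close> is a generator of \<open>\<tau>\<close> other than
        \<open>v i\<close>; the convention for this power is 1.\<close>
      have "log_power (?z k) (x k) (?b (v k)) = 1" if "k \<in> Z" for k
        using that False assms(3,4) dual_basis_generator[OF assms(2), of k i]
        by (auto simp: log_power_def point_def)
      then have "(\<Prod>k\<in>idx \<sigma>. log_power (?z k) (x k) (?b (v k))) =
          (\<Prod>k\<in>idx \<sigma> - Z. log_power (?z k) (x k) (?b (v k)))"
        using finite_idx by (intro prod.mono_neutral_right) auto
      also have "\<dots> = (\<Prod>k\<in>idx \<sigma> - Z. unit_exp (complex_of_real (?b (v k)) * x k))"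
        by (intro prod.cong) (auto simp: log_power_eq point_def)
      also have "\<dots> = unit_exp (complexify ?b \<xi>')"
        using finite_idx by (simp add: \<xi>'_def complexify_sum[OF lin] complexify_scale[OF lin]
            unit_exp_sum mult.commute)
      finally show ?thesis using False by simp
    qed
  qed
  then show ?thesis
    using orbit_point[OF assms(2)] point_eq_change_cone[OF assms(1-4) z] by simp
qed

text \<open>Every representative is \<open>point \<sigma> Z (\<xi> + (u, 0))\<close> for some
  \<open>u\<close> in \<open>Q\<close>, and translation by \<open>u\<close> leaves the resulting
  orbit unchanged, whatever logarithms are chosen.\<close>

lemma transition_chart_point:
  assumes "maximal_cone \<Sigma> \<sigma>" "maximal_cone \<Sigma> \<tau>"
    and "extremal_subcone (\<delta> \<inter> \<gamma>) \<sigma>" "extremal_subcone (\<delta> \<inter> \<gamma>) \<tau>"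
    and "Z \<subseteq> idx (\<delta> \<inter> \<gamma>)"
  shows "transition d v Q \<delta> \<sigma> \<gamma> \<tau> (chart_point \<sigma> Z \<xi>) = chart_point \<tau> Z \<xi>"
proof -
  have Z: "Z \<subseteq> idx \<sigma>" "Z \<subseteq> idx \<tau>"
    using assms(3-5) by (auto simp: extremal_subcone_def idx_def)
  let ?P = "\<lambda>y'. \<exists>z\<in>chart_point \<sigma> Z \<xi>. \<exists>x. log_choice (idx \<sigma>) z x \<and>
      y' = orbit (cone_group d v Q \<tau>) (cone_act d v \<tau>) (monomial_map d v \<sigma> \<tau> z x)"
  have "(THE y'. ?P y') = chart_point \<tau> Z \<xi>"
  proof (rule the_equality)
    obtain x where "log_choice (idx \<sigma>) (point \<sigma> Z \<xi>) x" using log_choice_exists by blast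
    then show "?P (chart_point \<tau> Z \<xi>)"
      using point_in_chart_point monomial_map_point[OF assms(1,2) Z] by metis
  next
    fix y' assume "?P y'"
    then obtain u x where u: "u \<in> Q" and x: "log_choice (idx \<sigma>) (point \<sigma> Z (\<xi> + (u, 0))) x"
      and y': "y' = orbit (cone_group d v Q \<tau>) (cone_act d v \<tau>)
        (monomial_map d v \<sigma> \<tau> (point \<sigma> Z (\<xi> + (u, 0))) x)"
      by (auto simp: chart_point_def)
    then show "y' = chart_point \<tau> Z \<xi>"
      using monomial_map_point[OF assms(1,2) Z x] chart_point_translate[OF u] by simp
  qed
  moreover have "chart_point \<sigma> Z \<xi> \<in> chart d v Q \<sigma> (\<delta> \<inter> \<gamma>)"
    using assms(5) chart_eq[OF assms(1,3)] by blast
  ultimately show ?thesis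
    unfolding transition_def max_index_eq[OF assms(1)] by simp
qed

section \<open>The gluing relation\<close>

text \<open>Both \<open>\<delta>\<close> and \<open>\<gamma>\<close> are cones of the fan, so their
  intersection is a face of \<open>\<delta>\<close>, and extremality passes up to
  \<open>\<sigma>\<close>.\<close>

lemma face_pairs_Int:
  assumes "(\<delta>, \<sigma>) \<in> face_pairs \<Sigma>" "(\<gamma>, \<tau>) \<in> face_pairs \<Sigma>"
  shows "extremal_subcone (\<delta> \<inter> \<gamma>) \<sigma>"
proof (rule extremal_subcone_trans)
  show "extremal_subcone (\<delta> \<inter> \<gamma>) \<delta>"
    using assms by (intro cone_face_extremal fan_Int_face) (auto simp: face_pairs_def)
  show "extremal_subcone \<delta> \<sigma>"
    using assms by (intro cone_face_extremal) (auto simp: face_pairs_def)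
qed

text \<open>Removes the transition map and leaves a condition symmetric in the two points: a common
  name whose rays lie in both faces.\<close>

lemma glue_rel_iff:
  "(((\<delta>, \<sigma>), y), ((\<gamma>, \<tau>), y')) \<in> glue_rel \<Sigma> Q d v \<longleftrightarrow>
     (\<delta>, \<sigma>) \<in> face_pairs \<Sigma> \<and> (\<gamma>, \<tau>) \<in> face_pairs \<Sigma> \<and>
     (\<exists>Z \<xi>. Z \<subseteq> idx \<delta> \<inter> idx \<gamma> \<and> y = chart_point \<sigma> Z \<xi> \<and> y' = chart_point \<tau> Z \<xi>)"
    (is "?L \<longleftrightarrow> ?R")
proof (cases "(\<delta>, \<sigma>) \<in> face_pairs \<Sigma> \<and> (\<gamma>, \<tau>) \<in> face_pairs \<Sigma>")
  case True
  then have max: "maximal_cone \<Sigma> \<sigma>" "maximal_cone \<Sigma> \<tau>"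
    and \<delta>: "extremal_subcone \<delta> \<sigma>" and \<gamma>: "extremal_subcone \<gamma> \<tau>"
    by (auto simp: face_pairs_def cone_face_extremal)
  have Int: "extremal_subcone (\<delta> \<inter> \<gamma>) \<sigma>" "extremal_subcone (\<delta> \<inter> \<gamma>) \<tau>"
    using face_pairs_Int[of \<delta> \<sigma> \<gamma> \<tau>] face_pairs_Int[of \<gamma> \<tau> \<delta> \<sigma>] True by (simp_all add: Int_commute)
  note charts = chart_eq[OF max(1) Int(1)] chart_eq[OF max(2) Int(2)]
    chart_eq[OF max(1) \<delta>] chart_eq[OF max(2) \<gamma>]
  note trans = transition_chart_point[OF max Int]
  have "?L \<longleftrightarrow> y \<in> chart d v Q \<sigma> \<delta> \<and> y' \<in> chart d v Q \<tau> \<gamma> \<and>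
      y \<in> chart d v Q \<sigma> (\<delta> \<inter> \<gamma>) \<and> y' \<in> chart d v Q \<tau> (\<delta> \<inter> \<gamma>) \<and>
      y' = transition d v Q \<delta> \<sigma> \<gamma> \<tau> y"
    using True by (auto simp: glue_rel_def total_space_def)
  also have "\<dots> \<longleftrightarrow> (\<exists>Z \<xi>. Z \<subseteq> idx (\<delta> \<inter> \<gamma>) \<and> y = chart_point \<sigma> Z \<xi> \<and> y' = chart_point \<tau> Z \<xi>)"
    (is "?A \<longleftrightarrow> ?B")
  proof
    assume ?A
    then obtain Z \<xi> where "Z \<subseteq> idx (\<delta> \<inter> \<gamma>)" "y = chart_point \<sigma> Z \<xi>"
      unfolding charts by blast
    with \<open>?A\<close> trans show ?B by blast
  next
    assume ?B
    then obtain Z \<xi> where *: "Z \<subseteq> idx (\<delta> \<inter> \<gamma>)" "y = chart_point \<sigma> Z \<xi>" "y' = chart_point \<tau> Z \<xi>"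
      by blast
    moreover from *(1) have "Z \<subseteq> idx \<delta>" "Z \<subseteq> idx \<gamma>" by (auto simp: idx_def)
    moreover from * trans have "y' = transition d v Q \<delta> \<sigma> \<gamma> \<tau> y" by simp
    ultimately show ?A unfolding charts by blast
  qed
  finally show ?thesis using True by (simp add: idx_Int)
next
  case False
  then show ?thesis by (auto simp: glue_rel_def total_space_def)
qed

lemma equiv_glue_rel: "equiv (total_space \<Sigma> Q d v) (glue_rel \<Sigma> Q d v)"
proof (rule equivI)
  show "glue_rel \<Sigma> Q d v \<subseteq> total_space \<Sigma> Q d v \<times> total_space \<Sigma> Q d v"
    by (auto simp: glue_rel_def)
  show "refl_on (total_space \<Sigma> Q d v) (glue_rel \<Sigma> Q d v)"
  proof (rule refl_onI)
    fix p assume "p \<in> total_space \<Sigma> Q d v"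
    then obtain \<delta> \<sigma> y where p: "p = ((\<delta>, \<sigma>), y)" "(\<delta>, \<sigma>) \<in> face_pairs \<Sigma>" "y \<in> chart d v Q \<sigma> \<delta>"
      by (auto simp: total_space_def)
    moreover from p(2) have "maximal_cone \<Sigma> \<sigma>" "extremal_subcone \<delta> \<sigma>"
      by (auto simp: face_pairs_def cone_face_extremal)
    ultimately show "(p, p) \<in> glue_rel \<Sigma> Q d v"
      using chart_eq by (auto simp: glue_rel_iff)
  qed
  show "sym (glue_rel \<Sigma> Q d v)"
    by (rule symI) (clarsimp simp: glue_rel_iff, blast)
  show "trans (glue_rel \<Sigma> Q d v)"
  proof (rule transI, clarify)
    fix \<delta> \<sigma> y \<gamma> \<tau> y' \<epsilon> \<kappa> y''
    assume "(((\<delta>, \<sigma>), y), ((\<gamma>, \<tau>), y')) \<in> glue_rel \<Sigma> Q d v"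
      and "(((\<gamma>, \<tau>), y'), ((\<epsilon>, \<kappa>), y'')) \<in> glue_rel \<Sigma> Q d v"
    then obtain Z \<xi> Z' \<xi>'
      where faces: "(\<delta>, \<sigma>) \<in> face_pairs \<Sigma>" "(\<gamma>, \<tau>) \<in> face_pairs \<Sigma>" "(\<epsilon>, \<kappa>) \<in> face_pairs \<Sigma>"
        and Z: "Z \<subseteq> idx \<delta> \<inter> idx \<gamma>" "y = chart_point \<sigma> Z \<xi>" "y' = chart_point \<tau> Z \<xi>"
        and Z': "Z' \<subseteq> idx \<gamma> \<inter> idx \<epsilon>" "y' = chart_point \<tau> Z' \<xi>'" "y'' = chart_point \<kappa> Z' \<xi>'"
      by (auto simp: glue_rel_iff)
    have max: "maximal_cone \<Sigma> \<tau>" "maximal_cone \<Sigma> \<kappa>"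
      and sub: "idx \<gamma> \<subseteq> idx \<tau>" "idx \<epsilon> \<subseteq> idx \<kappa>"
      using faces by (auto simp: face_pairs_def idx_def extremal_subcone_def dest!: cone_face_extremal)
    \<comment> \<open>The middle point carries two names; they are compared in the chart of
      \<open>\<tau>\<close>.\<close>
    have eq: "chart_point \<tau> Z \<xi> = chart_point \<tau> Z' \<xi>'" "Z \<subseteq> idx \<tau>" "Z' \<subseteq> idx \<tau>"
      using Z Z' sub by auto
    have "Z = Z'" using chart_point_eqD(1)[OF max(1) eq(2,3,1)] .
    then have "Z \<subseteq> idx \<kappa>" using Z'(1) sub(2) by auto
    then have "y'' = chart_point \<kappa> Z \<xi>"
      unfolding Z'(3) by (rule chart_point_eqD(2)[OF max(1) eq(2,3,1) max(2), symmetric])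
    \<comment> \<open>Equality of the zero sets puts the rays of \<open>Z\<close> in all three
      faces, in particular in \<open>\<delta> \<inter> \<epsilon>\<close>.\<close>
    moreover have "Z \<subseteq> idx \<delta> \<inter> idx \<epsilon>" using \<open>Z = Z'\<close> Z(1) Z'(1) by auto
    ultimately show "(((\<delta>, \<sigma>), y), ((\<epsilon>, \<kappa>), y'')) \<in> glue_rel \<Sigma> Q d v"
      unfolding glue_rel_iff using faces Z(2) by blast
  qed
qed

end

theorem theorem4p1:
  fixes \<Sigma> :: "(real ^ 'n) set set" and Q :: "(real ^ 'n) set"
    and d :: nat and v :: "nat \<Rightarrow> real ^ 'n"
  assumes "fan_triple \<Sigma> Q d v"
    and "convex (fan_support \<Sigma>)"
    and "aff_dim (fan_support \<Sigma>) = int CARD('n)"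
  shows "equiv (total_space \<Sigma> Q d v) (glue_rel \<Sigma> Q d v)"
  by (rule fan.equiv_glue_rel, rule fan.intro, rule assms(1))

end
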